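(* Let $A$ be a finite multiset (or set) of positive integers with $\#A=k$, and let $d$ be a fixed integer with $1\leqslant 2d<k$. Suppose that $\gcd B=1$ for every $(k-2d)$-element multisubset $B\subset A$. Then, for every integer $1\leqslant j\leqslant d$, the sequence $(p_A(n))_{n=0}^\infty$ satisfies the Laguerre inequality of order $j$ at $n$ for all but finitely many values of $n$.
   Context: For a finite multiset $A=\{a_1,a_2,\ldots,a_k\}$ of positive integers (cardinality $\#A=k$ counted with multiplicity), the $A$-partition function $p_A(n)$ is the number of partitions of $n$ with parts in $A$, where the order of the parts is irrelevant and equal elements of the multiset $A$ are regarded as distinguishable (differently coloured) parts. Equivalently, $p_A(n)$ is given by the generating function $$\sum_{n=0}^\infty p_A(n)x^n=\prod_{i=1}^k\frac{1}{1-x^{a_i}}.$$ A $(k-2d)$-element multisubset of $A$ is a multiset $\{a_i : i\in I\}$ with $I\subset\{1,\ldots,k\}$, $\#I=k-2d$, and $\gcd B$ is the greatest common divisor of all elements of $B$ (so the gcd of a one-element multiset is its element). For a fixed non-negative integer $d$, a sequence $\omega=(\omega_i)_{i=0}^\infty$ of real numbers satisfies the Laguerre inequality of order $d$ at $n$ if $$\sum_{i=0}^{2d}(-1)^{i+d}\binom{2d}{i}\omega_{n+i}\,\omega_{n+2d-i}\geqslant0.$$ *)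

theory Defs
  imports
    Complex_Main
    "HOL-Library.Multiset"
    "HOL-Computational_Algebra.Formal_Power_Series"
begin

text \<open>
  Equal elements of \<open>A\<close> are told apart by a colour: the \<open>count A a\<close> copies of \<open>a\<close> are the
  pairs \<open>(a, c)\<close> with \<open>c < count A a\<close>.  A partition with parts in \<open>A\<close> is a
  multiset of such coloured parts, since the order of the parts is irrelevant.
\<close>

definition coloured_parts :: "nat multiset \<Rightarrow> (nat \<times> nat) set" where
  "coloured_parts A = {(a, c). c < count A a}"

definition A_partitions :: "nat multiset \<Rightarrow> nat \<Rightarrow> (nat \<times> nat) multiset set" where
  "A_partitions A n =
     {P. set_mset P \<subseteq> coloured_parts A \<and> sum_mset (image_mset fst P) = n}"

text \<open>The number below is meaningful only if all elements of \<open>A\<close> are positive; otherwise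
  the set of partitions may be infinite, and its \<open>card\<close> is then \<open>0\<close>.\<close>

definition A_partition_function :: "nat multiset \<Rightarrow> nat \<Rightarrow> nat" where
  "A_partition_function A n = card (A_partitions A n)"

definition laguerre_inequality :: "nat \<Rightarrow> (nat \<Rightarrow> real) \<Rightarrow> nat \<Rightarrow> bool" where
  "laguerre_inequality d \<omega> n \<longleftrightarrow>
     (\<Sum>i = 0..2 * d. (- 1) ^ (i + d) * real ((2 * d) choose i) * \<omega> (n + i) * \<omega> (n + 2 * d - i)) \<ge> 0"

text \<open>The rest of the theory relates the combinatorial definition to the generating function.\<close>

lemma coloured_parts_empty: "coloured_parts {#} = {}"
  by (simp add: coloured_parts_def)

lemma coloured_parts_add_mset:
  "coloured_parts (add_mset a A) = insert (a, count A a) (coloured_parts A)"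
  by (auto simp: coloured_parts_def split: if_splits)

lemma finite_coloured_parts: "finite (coloured_parts A)"
  by (induction A) (simp_all add: coloured_parts_empty coloured_parts_add_mset)

lemma fst_coloured_parts: "s \<in> coloured_parts A \<Longrightarrow> fst s \<in># A"
  by (auto simp: coloured_parts_def simp flip: count_greater_zero_iff)

lemma finite_A_partitions:
  assumes "\<forall>a \<in># A. a > 0"
  shows "finite (A_partitions A n)"
proof (induction n rule: less_induct)
  case (less n)
  have "A_partitions A n \<subseteq>
      insert {#} (\<Union>s \<in> {s \<in> coloured_parts A. fst s \<le> n}. add_mset s ` A_partitions A (n - fst s))"
  proof
    fix P assume P: "P \<in> A_partitions A n"
    show "P \<in> insert {#} (\<Union>s \<in> {s \<in> coloured_parts A. fst s \<le> n}.
        add_mset s ` A_partitions A (n - fst s))"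
    proof (cases P)
      case (add s Q)
      then have "s \<in> coloured_parts A" "fst s \<le> n" "Q \<in> A_partitions A (n - fst s)"
        using P by (auto simp: A_partitions_def)
      then show ?thesis using add by blast
    qed simp
  qed
  moreover have "finite (A_partitions A (n - fst s))"
    if "s \<in> coloured_parts A" "fst s \<le> n" for s
  proof -
    have "fst s > 0" using assms that(1) fst_coloured_parts by blast
    then show ?thesis using less that(2) by simp
  qed
  ultimately show ?case
    by (elim finite_subset) (auto simp: finite_coloured_parts)
qed

lemma A_partition_function_empty: "A_partition_function {#} n = (if n = 0 then 1 else 0)"
proof -
  have "A_partitions {#} n = (if n = 0 then {{#}} else {})"
    by (auto simp: A_partitions_def coloured_parts_empty)
  then show ?thesis by (simp add: A_partition_function_def)
qed

lemma A_partition_function_add_mset: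
  assumes "\<forall>b \<in># add_mset a A. b > 0"
  shows "A_partition_function (add_mset a A) n =
    A_partition_function A n + (if a \<le> n then A_partition_function (add_mset a A) (n - a) else 0)"
proof -
  let ?s = "(a, count A a)"
  let ?T = "if a \<le> n then add_mset ?s ` A_partitions (add_mset a A) (n - a) else {}"
  have s: "?s \<notin> coloured_parts A"
    by (simp add: coloured_parts_def)
  have "A_partitions (add_mset a A) n = A_partitions A n \<union> ?T"
  proof (intro set_eqI iffI)
    fix P assume P: "P \<in> A_partitions (add_mset a A) n"
    show "P \<in> A_partitions A n \<union> ?T"
    proof (cases "?s \<in># P")
      case True
      then obtain Q where Q: "P = add_mset ?s Q" by (metis mset_add)
      then have "a \<le> n" "Q \<in> A_partitions (add_mset a A) (n - a)"
        using P by (auto simp: A_partitions_def)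
      then show ?thesis using Q by auto
    next
      case False
      then show ?thesis using P by (auto simp: A_partitions_def coloured_parts_add_mset)
    qed
  next
    fix P assume "P \<in> A_partitions A n \<union> ?T"
    then show "P \<in> A_partitions (add_mset a A) n"
      by (auto simp: A_partitions_def coloured_parts_add_mset split: if_splits)
  qed
  moreover have "A_partitions A n \<inter> ?T = {}"
  proof -
    have "?s \<notin># P" if "P \<in> A_partitions A n" for P
      using s that unfolding A_partitions_def by blast
    moreover have "?s \<in># P" if "P \<in> ?T" for P
      using that by (auto split: if_splits)
    ultimately show ?thesis by blast
  qed
  moreover have "finite (A_partitions A n)"
    using assms by (intro finite_A_partitions) simp
  moreover have "finite ?T"
    using finite_A_partitions[OF assms] by simp
  ultimately have "A_partition_function (add_mset a A) n = A_partition_function A n + card ?T"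
    unfolding A_partition_function_def by (metis card_Un_disjoint)
  then show ?thesis
    by (simp add: A_partition_function_def card_image inj_on_def)
qed

lemma A_partition_function_gf:
  assumes "\<forall>a \<in># A. a > 0"
  shows "Abs_fps (\<lambda>n. real (A_partition_function A n)) = (\<Prod>a\<in>#A. inverse (1 - fps_X ^ a))"
  using assms
proof (induction A)
  case empty
  show ?case by (rule fps_ext) (simp add: A_partition_function_empty)
next
  case (add a A)
  let ?F = "Abs_fps (\<lambda>n. real (A_partition_function (add_mset a A) n))"
  let ?G = "Abs_fps (\<lambda>n. real (A_partition_function A n))"
  have "?F = ?G + ?F * fps_X ^ a"
  proof (rule fps_ext)
    fix n
    show "fps_nth ?F n = fps_nth (?G + ?F * fps_X ^ a) n"
      using A_partition_function_add_mset[OF add.prems, of n]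
      by (auto simp: fps_X_power_mult_right_nth)
  qed
  then have "?F * (1 - fps_X ^ a) = ?G"
    by (simp add: algebra_simps)
  moreover have "fps_nth (1 - fps_X ^ a :: real fps) 0 \<noteq> 0"
    using add.prems by simp
  ultimately have "?F = ?G * inverse (1 - fps_X ^ a)"
    by (metis inverse_mult_eq_1' mult.assoc mult.right_neutral)
  then show ?case using add by (simp add: mult.commute)
qed

end

theory Submission
  imports
    Defs
    "HOL-Computational_Algebra.Fundamental_Theorem_Algebra"
    "HOL-Computational_Algebra.Polynomial_FPS"
begin

text \<open>
  Write \<open>p\<close> for the partition function of \<open>A\<close>, \<open>m = k - 1\<close>, and \<open>\<Delta>\<close> for the forward difference.
  The Laguerre expression is bilinear and is unchanged when shifts are replaced by differences:
  it equals \<open>(-1)^j (\<Sum>i\<le>2j. (-1)^i (2j choose i) \<Delta>^i p(n) \<Delta>^(2j-i) p(n))\<close>.  Suppose that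
  \<open>\<Delta>^i p(n)\<close> is asymptotic to \<open>c n^(m-i) / (m-i)!\<close> for all \<open>i \<le> 2d\<close>, with one real \<open>c \<noteq> 0\<close>
  (as if \<open>p\<close> were the polynomial \<open>c n^m / m!\<close>).  Then every summand has the same order
  \<open>n^(2m-2j)\<close>, and the coefficients add up to \<open>c^2 (2j)! (m choose j) / (m!)^2\<close>, which is positive;
  so the inequality is even strict for large \<open>n\<close> (\<open>eventually_laguerre_inequality\<close>).

  The hypothesis on greatest common divisors is what makes the differences behave like this.  The
  generating function of \<open>p\<close> is a product of factors \<open>1 / (1 - z x)\<close> with \<open>z\<close> ranging over a
  multiset of roots of unity, in which \<open>z\<close> occurs as often as there are \<open>a\<close> in \<open>A\<close> with
  \<open>z^a = 1\<close>.  Thus \<open>1\<close> occurs \<open>k\<close> times.  If some \<open>z \<noteq> 1\<close> occurred \<open>k - 2d\<close> times, then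
  \<open>z^g = 1\<close> for the greatest common divisor \<open>g = 1\<close> of \<open>k - 2d\<close> elements of \<open>A\<close>, which is
  absurd (\<open>count_pole_multiset_less\<close>).  Taking \<open>\<Delta>^i\<close> cancels \<open>i\<close> of the factors with
  \<open>z = 1\<close>.  For \<open>i \<le> 2d\<close> at least \<open>k - 2d\<close> of them remain, more than of any other kind, so the pole
  at \<open>1\<close> still dominates and determines the growth (\<open>geometric_product_asymptotic\<close>).
  The constant \<open>c\<close>, the product of all \<open>1 / (1 - z)\<close> with \<open>z \<noteq> 1\<close>, is visibly the same for
  every \<open>i\<close>; it is nonzero, and real as a limit of real numbers.
\<close>

section \<open>The Laguerre expression in terms of differences\<close>

text \<open>
  Pascal's rule, read as follows: an alternating binomial sum of order \<open>N + 1\<close> arises from one of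
  order \<open>N\<close> by one application of the operator \<open>F i j \<mapsto> F i (j + 1) - F (i + 1) j\<close>.
\<close>

lemma alternating_binomial_sum_Suc:
  fixes F :: "nat \<Rightarrow> nat \<Rightarrow> 'a :: comm_ring_1"
  shows "(\<Sum>i\<le>Suc N. (- 1) ^ i * of_nat (Suc N choose i) * F i (Suc N - i)) =
    (\<Sum>i\<le>N. (- 1) ^ i * of_nat (N choose i) * (F i (Suc (N - i)) - F (Suc i) (N - i)))"
proof -
  have "(\<Sum>i\<le>Suc N. (- 1) ^ i * of_nat (Suc N choose i) * F i (Suc N - i)) =
      F 0 (Suc N) + (\<Sum>i\<le>N. (- 1) ^ Suc i * of_nat (N choose Suc i) * F (Suc i) (N - i))
        - (\<Sum>i\<le>N. (- 1) ^ i * of_nat (N choose i) * F (Suc i) (N - i))"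
    by (subst sum.atMost_Suc_shift)
       (simp add: algebra_simps sum.distrib sum_subtractf sum_negf flip: sum.distrib)
  also have "F 0 (Suc N) + (\<Sum>i\<le>N. (- 1) ^ Suc i * of_nat (N choose Suc i) * F (Suc i) (N - i)) =
      (\<Sum>i\<le>Suc N. (- 1) ^ i * of_nat (N choose i) * F i (Suc N - i))"
    by (subst sum.atMost_Suc_shift) simp
  also have "\<dots> = (\<Sum>i\<le>N. (- 1) ^ i * of_nat (N choose i) * F i (Suc (N - i)))"
    by (simp add: Suc_diff_le binomial_eq_0)
  finally show ?thesis
    by (simp add: sum_subtractf right_diff_distrib)
qed

definition forward_difference :: "(nat \<Rightarrow> 'a :: ab_group_add) \<Rightarrow> nat \<Rightarrow> 'a" where
  "forward_difference u n = u (Suc n) - u n"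

text \<open>
  Let \<open>E1\<close> and \<open>E2\<close> shift the first and the second argument of \<open>u a * v b\<close>.  The left-hand side is
  \<open>(E2 - E1)^N\<close> applied to this function, and \<open>E2 - E1 = (1 + \<Delta>2) - (1 + \<Delta>1) = \<Delta>2 - \<Delta>1\<close>.
\<close>
lemma alternating_binomial_sum_forward_difference:
  fixes u v :: "nat \<Rightarrow> 'a :: comm_ring_1"
  shows "(\<Sum>i\<le>N. (- 1) ^ i * of_nat (N choose i) * (u (n + i) * v (n + (N - i)))) =
    (\<Sum>i\<le>N. (- 1) ^ i * of_nat (N choose i) *
       ((forward_difference ^^ i) u n * (forward_difference ^^ (N - i)) v n))"
proof (induction N arbitrary: u v)
  case 0
  show ?case by simp
next
  case (Suc N)
  let ?S = "\<lambda>F. \<Sum>i\<le>N. (- 1) ^ i * of_nat (N choose i) * F i (N - i)"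
  let ?d = "forward_difference :: (nat \<Rightarrow> 'a) \<Rightarrow> _"
  have "(\<Sum>i\<le>Suc N. (- 1) ^ i * of_nat (Suc N choose i) * (u (n + i) * v (n + (Suc N - i)))) =
      ?S (\<lambda>i j. u (n + i) * v (n + Suc j) - u (n + Suc i) * v (n + j))"
    by (rule alternating_binomial_sum_Suc)
  also have "\<dots> = ?S (\<lambda>i j. u (n + i) * ?d v (n + j)) - ?S (\<lambda>i j. ?d u (n + i) * v (n + j))"
    by (simp add: forward_difference_def algebra_simps flip: sum_subtractf)
  also have "\<dots> = ?S (\<lambda>i j. (?d ^^ i) u n * (?d ^^ j) (?d v) n)
      - ?S (\<lambda>i j. (?d ^^ i) (?d u) n * (?d ^^ j) v n)"
    by (simp only: Suc.IH)
  also have "\<dots> = ?S (\<lambda>i j. (?d ^^ i) u n * (?d ^^ Suc j) v n - (?d ^^ Suc i) u n * (?d ^^ j) v n)"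
    by (simp add: right_diff_distrib sum_subtractf funpow_Suc_right del: funpow.simps)
  also have "\<dots> = (\<Sum>i\<le>Suc N. (- 1) ^ i * of_nat (Suc N choose i) *
      ((?d ^^ i) u n * (?d ^^ (Suc N - i)) v n))"
    by (rule alternating_binomial_sum_Suc[symmetric])
  finally show ?case .
qed

lemma laguerre_inequality_iff_forward_difference:
  "laguerre_inequality j \<omega> n \<longleftrightarrow>
    (- 1) ^ j * (\<Sum>i\<le>2 * j. (- 1) ^ i * real (2 * j choose i) *
      ((forward_difference ^^ i) \<omega> n * (forward_difference ^^ (2 * j - i)) \<omega> n)) \<ge> 0"
proof -
  have "(\<Sum>i = 0..2 * j. (- 1) ^ (i + j) * real (2 * j choose i) * \<omega> (n + i) * \<omega> (n + 2 * j - i)) =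
     (- 1) ^ j * (\<Sum>i\<le>2 * j. (- 1) ^ i * real (2 * j choose i) * (\<omega> (n + i) * \<omega> (n + (2 * j - i))))"
    by (auto simp: sum_distrib_left power_add atMost_atLeast0 intro!: sum.cong)
  then show ?thesis
    by (simp only: laguerre_inequality_def alternating_binomial_sum_forward_difference)
qed


section \<open>Positivity of the leading coefficient\<close>

lemma fps_nth_binomial_power:
  fixes c :: "'a :: comm_ring_1"
  assumes "k > 0"
  shows "fps_nth ((1 + fps_const c * fps_X ^ k) ^ m) (k * i) = of_nat (m choose i) * c ^ i"
proof -
  have "(1 + fps_const c * fps_X ^ k) ^ m =
      (\<Sum>l\<le>m. fps_const (of_nat (m choose l) * c ^ l) * fps_X ^ (k * l))"
    by (subst add.commute, subst binomial_ring)
       (simp add: power_mult_distrib fps_of_nat mult.assoc flip: power_mult fps_const_mult fps_const_power)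
  then have "fps_nth ((1 + fps_const c * fps_X ^ k) ^ m) (k * i) =
      (\<Sum>l\<le>m. fps_nth (fps_const (of_nat (m choose l) * c ^ l) * fps_X ^ (k * l)) (k * i))"
    by (simp only: fps_sum_nth)
  also have "\<dots> = (\<Sum>l\<le>m. if l = i then of_nat (m choose i) * c ^ i else 0)"
    by (rule sum.cong) (use assms in auto)
  finally show ?thesis
    by (simp add: binomial_eq_0)
qed

text \<open>Both sides are the coefficient of \<open>x^(2j)\<close> in \<open>(1 - x)^m (1 + x)^m = (1 - x^2)^m\<close>.\<close>
lemma alternating_binomial_convolution:
  "(\<Sum>i\<le>2 * j. (- 1) ^ i * of_nat (m choose i) * of_nat (m choose (2 * j - i))) =
    ((- 1) ^ j * of_nat (m choose j) :: 'a :: comm_ring_1)"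
proof -
  let ?P = "\<lambda>c k. (1 + fps_const c * fps_X ^ k :: 'a fps)"
  have "?P (- 1) 1 ^ m * ?P 1 1 ^ m = ?P (- 1) 2 ^ m"
    by (simp add: power2_eq_square algebra_simps flip: power_mult_distrib fps_const_neg)
  then have "fps_nth (?P (- 1) 1 ^ m * ?P 1 1 ^ m) (2 * j) = fps_nth (?P (- 1) 2 ^ m) (2 * j)"
    by (rule arg_cong)
  then have "(\<Sum>i\<le>2 * j. fps_nth (?P (- 1) 1 ^ m) i * fps_nth (?P 1 1 ^ m) (2 * j - i)) =
      fps_nth (?P (- 1) 2 ^ m) (2 * j)"
    by (simp only: fps_mult_nth atMost_atLeast0)
  then show ?thesis
    using fps_nth_binomial_power[of 1 "-1 :: 'a" m] fps_nth_binomial_power[of 1 "1 :: 'a" m]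
      fps_nth_binomial_power[of 2 "-1 :: 'a" m j]
    by (simp add: mult_ac)
qed

lemma binomial_div_fact:
  assumes "i \<le> N" "N \<le> m"
  shows "real (N choose i) / (fact (m - i) * fact (m - (N - i))) =
    fact N / fact m ^ 2 * (real (m choose i) * real (m choose (N - i)))"
proof -
  have "x / (a * b) / (c * d) = x / y ^ 2 * (y / (a * c) * (y / (b * d)))"
    if "y \<noteq> 0" for x y a b c d :: real
    using that by (simp add: power2_eq_square mult_ac)
  then show ?thesis
    using assms by (simp only: binomial_fact le_trans[OF _ assms(2)] diff_le_self fact_nonzero not_False_eq_True)
qed

text \<open>
  A sequence whose differences up to order \<open>2j\<close> grow like those of the polynomial
  \<open>c n^m / m!\<close>.  Asymptotics of the sequence alone would not do: the leading terms
  of the Laguerre expression cancel, and only the differences show what survives.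
\<close>
lemma eventually_laguerre_inequality:
  fixes \<omega> :: "nat \<Rightarrow> real"
  assumes c: "c \<noteq> 0" and j: "2 * j \<le> m"
    and lim: "\<And>i. i \<le> 2 * j \<Longrightarrow>
      (\<lambda>n. (forward_difference ^^ i) \<omega> n / real n ^ (m - i)) \<longlonglongrightarrow> c / fact (m - i)"
  shows "eventually (\<lambda>n. laguerre_inequality j \<omega> n) sequentially"
proof -
  let ?D = "\<lambda>i. (forward_difference ^^ i) \<omega>"
  let ?L = "\<lambda>n. (- 1) ^ j * (\<Sum>i\<le>2 * j. (- 1) ^ i * real (2 * j choose i) * (?D i n * ?D (2 * j - i) n))"
  let ?T = "\<lambda>n. (- 1) ^ j * (\<Sum>i\<le>2 * j. (- 1) ^ i * real (2 * j choose i) *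
      (?D i n / real n ^ (m - i) * (?D (2 * j - i) n / real n ^ (m - (2 * j - i)))))"
  have "?T \<longlonglongrightarrow> (- 1) ^ j * (\<Sum>i\<le>2 * j. (- 1) ^ i * real (2 * j choose i) *
      (c / fact (m - i) * (c / fact (m - (2 * j - i)))))"
    by (intro tendsto_intros lim) auto
  also have "(\<Sum>i\<le>2 * j. (- 1) ^ i * real (2 * j choose i) *
      (c / fact (m - i) * (c / fact (m - (2 * j - i))))) =
      (\<Sum>i\<le>2 * j. c ^ 2 * (- 1) ^ i * (real (2 * j choose i) / (fact (m - i) * fact (m - (2 * j - i)))))"
    by (simp add: power2_eq_square field_simps)
  also have "\<dots> = (\<Sum>i\<le>2 * j. c ^ 2 * fact (2 * j) / fact m ^ 2 *
      ((- 1) ^ i * real (m choose i) * real (m choose (2 * j - i))))"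
    by (rule sum.cong[OF refl], subst binomial_div_fact) (use j in auto)
  also have "\<dots> = c ^ 2 * fact (2 * j) / fact m ^ 2 * ((- 1) ^ j * real (m choose j))"
    by (simp only: alternating_binomial_convolution flip: sum_distrib_left)
  finally have "?T \<longlonglongrightarrow> c ^ 2 * fact (2 * j) / fact m ^ 2 * real (m choose j)"
    by (simp add: mult_ac flip: power_mult_distrib)
  moreover have "c ^ 2 * fact (2 * j) / fact m ^ 2 * real (m choose j) > 0"
    using c j by simp
  ultimately have "eventually (\<lambda>n. ?T n > 0) sequentially"
    by (rule order_tendstoD(1))
  then show ?thesis
    using eventually_gt_at_top[of 0]
  proof eventually_elim
    case (elim n)
    \<comment> \<open>Every summand is homogeneous of the same degree, so the scaling comes out of the sum.\<close>
    have scale: "real n ^ (2 * m - 2 * j) *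
        (?D i n / real n ^ (m - i) * (?D (2 * j - i) n / real n ^ (m - (2 * j - i)))) =
        ?D i n * ?D (2 * j - i) n" if "i \<le> 2 * j" for i
    proof -
      have "2 * m - 2 * j = (m - i) + (m - (2 * j - i))"
        using that j by linarith
      then show ?thesis
        using elim by (simp add: power_add)
    qed
    have "real n ^ (2 * m - 2 * j) * ?T n = (- 1) ^ j * (\<Sum>i\<le>2 * j. (- 1) ^ i * real (2 * j choose i) *
        (real n ^ (2 * m - 2 * j) *
          (?D i n / real n ^ (m - i) * (?D (2 * j - i) n / real n ^ (m - (2 * j - i))))))"
      by (simp only: sum_distrib_left mult_ac)
    also have "\<dots> = ?L n"
      by (intro arg_cong[of _ _ "\<lambda>x. (- 1) ^ j * x"] sum.cong refl) (simp only: scale atMost_iff)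
    finally have "?L n = real n ^ (2 * m - 2 * j) * ?T n" ..
    then show ?case
      using elim by (simp only: laguerre_inequality_iff_forward_difference) simp
  qed
qed

section \<open>Growth of coefficients of products of geometric series\<close>

definition geometric_product :: "complex multiset \<Rightarrow> complex fps" where
  "geometric_product Z = (\<Prod>z\<in>#Z. inverse (1 - fps_const z * fps_X))"

lemma geometric_product_simps [simp]:
  "geometric_product {#} = 1"
  "geometric_product (add_mset z Z) = inverse (1 - fps_const z * fps_X) * geometric_product Z"
  "geometric_product (Y + Z) = geometric_product Y * geometric_product Z"
  by (simp_all add: geometric_product_def)

lemma geometric_product_cancel:
  "(1 - fps_const z * fps_X) * geometric_product (add_mset z Z) = geometric_product Z"
  by (simp add: inverse_mult_eq_1' flip: mult.assoc)

lemma geometric_product_add_mset_nth: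
  "fps_nth (geometric_product (add_mset z Z)) n = (\<Sum>i\<le>n. z ^ (n - i) * fps_nth (geometric_product Z) i)"
proof -
  have "inverse (1 - fps_const z * fps_X) = Abs_fps (\<lambda>n. z ^ n)"
  proof (rule fps_inverse_unique)
    show "(1 - fps_const z * fps_X) * Abs_fps (\<lambda>n. z ^ n) = 1"
      by (rule fps_ext) (auto simp: left_diff_distrib mult.assoc simp flip: power_Suc)
  qed
  then have "geometric_product (add_mset z Z) = geometric_product Z * Abs_fps (\<lambda>n. z ^ n)"
    by (simp add: mult.commute)
  then show ?thesis
    by (simp only: fps_mult_nth atMost_atLeast0 fps_nth_Abs_fps mult.commute)
qed

text \<open>
  One step of a partial fraction decomposition.  It trades two different factors for one, without
  raising any multiplicity, and so drives the inductions below.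
\<close>
lemma geometric_product_partial_fractions:
  assumes "z \<noteq> w"
  shows "fps_nth (geometric_product (add_mset z (add_mset w Z))) n =
    (z * fps_nth (geometric_product (add_mset z Z)) n - w * fps_nth (geometric_product (add_mset w Z)) n) / (z - w)"
proof -
  let ?P = "1 - fps_const z * fps_X" and ?Q = "1 - fps_const w * fps_X"
  let ?G = "geometric_product (add_mset z (add_mset w Z))"
  have z: "geometric_product (add_mset z Z) = ?Q * ?G"
    by (subst add_mset_commute) (rule geometric_product_cancel[symmetric])
  have w: "geometric_product (add_mset w Z) = ?P * ?G"
    by (rule geometric_product_cancel[symmetric])
  have "fps_const (z - w) * ?G = fps_const z * (?Q * ?G) - fps_const w * (?P * ?G)"
    by (simp only: fps_const_sub[symmetric]) algebra
  then have "fps_nth (fps_const (z - w) * ?G) n =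
      fps_nth (fps_const z * geometric_product (add_mset z Z) - fps_const w * geometric_product (add_mset w Z)) n"
    by (simp only: z w)
  then show ?thesis
    using assms by (simp only: fps_mult_left_const_nth fps_sub_nth) (simp add: field_simps)
qed

lemma multiset_replicate_or_distinct:
  obtains z where "Z = replicate_mset (size Z) z"
  | z w Y where "z \<noteq> w" "Z = add_mset z (add_mset w Y)"
proof (cases Z)
  case empty
  then show ?thesis using that(1) by simp
next
  case (add z Y)
  show ?thesis
  proof (cases "set_mset Z \<subseteq> {z}")
    case True
    then show ?thesis
      using that(1) by (metis set_mset_subset_singletonD)
  next
    case False
    then obtain w where "w \<in># Y" "w \<noteq> z"
      using add by auto
    then show ?thesis
      using that(2)[of z w "Y - {#w#}"] add by auto
  qed
qed

text \<open>
  Poles of order at most \<open>s + 1\<close> on or outside the unit circle give coefficients of size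
  \<open>O(n^s)\<close>.  Two different factors can be separated by partial fractions.  If all factors are equal,
  each further factor replaces the coefficients by weighted partial sums, with weights of modulus
  at most \<open>1\<close>, which costs one power of \<open>n\<close>.
\<close>
lemma geometric_product_bound:
  assumes "\<And>z. z \<in># Z \<Longrightarrow> norm z \<le> 1" "\<And>z. count Z z \<le> Suc s"
  obtains C where "\<And>n. norm (fps_nth (geometric_product Z) n) \<le> C * real (Suc n) ^ s"
proof -
  have "\<exists>C. \<forall>n. norm (fps_nth (geometric_product Z) n) \<le> C * real (Suc n) ^ s"
    using assms
  proof (induction "size Z" arbitrary: Z s rule: less_induct)
    case less
    show ?case
    proof (cases rule: multiset_replicate_or_distinct[of Z])
      case (1 z)
      show ?thesis
      proof (cases "Z = {#}")
        case True
        then have "norm (fps_nth (geometric_product Z) n) \<le> 1 * real (Suc n) ^ s" for n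
          by (cases n) auto
        then show ?thesis by blast
      next
        case False
        then obtain Y where Y: "Z = add_mset z Y" "Y = replicate_mset (size Y) z"
          using 1 by (metis Suc_pred' nonempty_has_size replicate_mset_Suc size_replicate_mset)
        have z: "norm z \<le> 1"
          using less.prems(1) Y by simp
        \<comment> \<open>For \<open>s = 0\<close> there is no smaller exponent to induct on, but then only one factor is left.\<close>
        have "\<exists>C\<ge>0. \<forall>n. (\<Sum>i\<le>n. norm (fps_nth (geometric_product Y) i)) \<le> C * real (Suc n) ^ s"
        proof (cases s)
          case 0
          have "count Y z = 0"
            using less.prems(2)[of z] Y(1) 0 by simp
          then have "Y = {#}"
            using Y(2) by (metis count_replicate_mset replicate_mset_0)
          then have "(\<Sum>i\<le>n. norm (fps_nth (geometric_product Y) i)) \<le> 1 * real (Suc n) ^ s" for n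
            using 0 by (simp add: if_distrib cong: if_cong)
          then show ?thesis by (intro exI[of _ 1]) simp
        next
          case (Suc t)
          have "count Y y \<le> Suc t" for y
            using less.prems(2)[of z] Y Suc
            by (metis Suc_le_mono count_add_mset count_replicate_mset le0)
          then obtain C where C: "\<And>n. norm (fps_nth (geometric_product Y) n) \<le> C * real (Suc n) ^ t"
            using less.hyps[of Y t] less.prems(1) Y(1) by auto
          have C0: "C \<ge> 0"
            using order_trans[OF norm_ge_zero C[of 0]] by simp
          have "(\<Sum>i\<le>n. norm (fps_nth (geometric_product Y) i)) \<le> C * real (Suc n) ^ s" for n
          proof -
            have "(\<Sum>i\<le>n. norm (fps_nth (geometric_product Y) i)) \<le> (\<Sum>i\<le>n. C * real (Suc n) ^ t)"
              by (intro sum_mono order_trans[OF C] mult_left_mono power_mono C0) auto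
            then show ?thesis
              by (simp add: Suc mult_ac)
          qed
          then show ?thesis using C0 by blast
        qed
        then obtain C where C: "\<And>n. (\<Sum>i\<le>n. norm (fps_nth (geometric_product Y) i)) \<le> C * real (Suc n) ^ s"
          by blast
        have "norm (fps_nth (geometric_product Z) n) \<le> C * real (Suc n) ^ s" for n
        proof -
          have "norm (fps_nth (geometric_product Z) n) \<le>
              (\<Sum>i\<le>n. norm (z ^ (n - i) * fps_nth (geometric_product Y) i))"
            unfolding Y(1) geometric_product_add_mset_nth by (rule norm_sum)
          also have "\<dots> \<le> (\<Sum>i\<le>n. norm (fps_nth (geometric_product Y) i))"
            using z by (intro sum_mono) (simp add: norm_mult norm_power mult_left_le_one_le power_le_one)
          finally show ?thesis using C[of n] by linarith
        qed
        then show ?thesis by blast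
      qed
    next
      case (2 z w Y)
      have count: "count (add_mset x Y) y \<le> Suc s" if "x = z \<or> x = w" for x y
        using less.prems(2)[of y] 2 that by (auto split: if_splits)
      have "\<exists>C. \<forall>n. norm (fps_nth (geometric_product (add_mset x Y)) n) \<le> C * real (Suc n) ^ s"
        if "x = z \<or> x = w" for x
        using that less.prems(1) 2 by (intro less.hyps count) auto
      then obtain B C where
        B: "\<And>n. norm (fps_nth (geometric_product (add_mset z Y)) n) \<le> B * real (Suc n) ^ s" and
        C: "\<And>n. norm (fps_nth (geometric_product (add_mset w Y)) n) \<le> C * real (Suc n) ^ s"
        by (metis (no_types))
      have zw: "norm z \<le> 1" "norm w \<le> 1"
        using less.prems(1) 2 by auto
      have "norm (fps_nth (geometric_product Z) n) \<le> (B + C) / norm (z - w) * real (Suc n) ^ s" for n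
      proof -
        let ?b = "fps_nth (geometric_product (add_mset z Y)) n"
        let ?c = "fps_nth (geometric_product (add_mset w Y)) n"
        have "norm (z * ?b - w * ?c) \<le> norm z * norm ?b + norm w * norm ?c"
          by (metis norm_mult norm_triangle_ineq4)
        also have "\<dots> \<le> norm ?b + norm ?c"
          by (intro add_mono mult_left_le_one_le zw) auto
        also have "\<dots> \<le> (B + C) * real (Suc n) ^ s"
          using B[of n] C[of n] by (simp add: distrib_right)
        finally have "norm (z * ?b - w * ?c) / norm (z - w) \<le> (B + C) * real (Suc n) ^ s / norm (z - w)"
          by (intro divide_right_mono) auto
        then show ?thesis
          unfolding 2(2) geometric_product_partial_fractions[OF 2(1)]
          by (simp only: norm_divide times_divide_eq_left)
      qed
      then show ?thesis by blast
    qed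
  qed
  then show ?thesis
    using that by blast
qed

lemma geometric_product_replicate_1_nth:
  "fps_nth (geometric_product (replicate_mset (Suc r) 1)) n = of_nat ((r + n) choose n)"
proof (induction r arbitrary: n)
  case 0
  show ?case
    using geometric_product_add_mset_nth[of 1 "{#}" n] by (simp add: if_distrib cong: if_cong)
next
  case (Suc r)
  have "fps_nth (geometric_product (replicate_mset (Suc (Suc r)) 1)) n =
      of_nat (\<Sum>i\<le>n. (r + i) choose i)"
    unfolding replicate_mset_Suc[of "Suc r"] geometric_product_add_mset_nth Suc.IH by simp
  then show ?case
    by (simp add: sum_choose_lower)
qed

lemma choose_asymptotic:
  "(\<lambda>n. of_nat ((r + n) choose n) / of_nat n ^ r) \<longlonglongrightarrow> (1 / fact r :: complex)"
proof (induction r)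
  case 0
  show ?case by simp
next
  case (Suc r)
  have "(\<lambda>n. 1 + of_nat (Suc r) * inverse (of_nat n)) \<longlonglongrightarrow> 1 + of_nat (Suc r) * (0 :: complex)"
    by (intro tendsto_intros lim_inverse_n)
  then have "(\<lambda>n. (of_nat ((r + n) choose n) / of_nat n ^ r) *
      ((1 + of_nat (Suc r) * inverse (of_nat n)) / of_nat (Suc r))) \<longlonglongrightarrow> (1 / fact r :: complex) * ((1 + of_nat (Suc r) * 0) / of_nat (Suc r))"
    by (rule tendsto_mult[OF Suc.IH tendsto_divide[OF _ tendsto_const]]) (simp del: of_nat_Suc)
  also have "(1 / fact r :: complex) * ((1 + of_nat (Suc r) * 0) / of_nat (Suc r)) = 1 / fact (Suc r)"
    by (simp add: field_simps)
  finally show ?case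
  proof (rule Lim_transform_eventually)
    show "\<forall>\<^sub>F n in sequentially. (of_nat ((r + n) choose n) / of_nat n ^ r) *
      ((1 + of_nat (Suc r) * inverse (of_nat n)) / of_nat (Suc r)) =
      (of_nat ((Suc r + n) choose n) / of_nat n ^ Suc r :: complex)"
      using eventually_gt_at_top[of 0]
    proof eventually_elim
      case (elim n)
      have "Suc r * (Suc (r + n) choose n) = Suc (r + n) * ((r + n) choose n)"
        using Suc_times_binomial_add[of r n] binomial_symmetric[of n "r + n"]
          binomial_symmetric[of n "Suc (r + n)"]
        by (metis Suc_times_binomial add_Suc add_diff_cancel_right' le_add2)
      then have "of_nat (Suc r) * of_nat (Suc (r + n) choose n) =
          (of_nat (Suc (r + n)) * of_nat ((r + n) choose n) :: complex)"
        by (metis of_nat_mult)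
      then have "(of_nat (Suc (r + n) choose n) :: complex) =
          of_nat (Suc (r + n)) * of_nat ((r + n) choose n) / of_nat (Suc r)"
        by (simp add: eq_divide_eq mult.commute del: of_nat_Suc)
      moreover have "1 + of_nat (Suc r) * inverse (of_nat n) = (of_nat (Suc (r + n)) / of_nat n :: complex)"
        using elim by (simp add: field_simps)
      ultimately show ?case
        by (simp add: mult_ac del: of_nat_Suc)
    qed
  qed
qed

text \<open>
  The pole at \<open>1\<close> has order \<open>r + 1\<close> and every other one has smaller order, so it alone determines the
  growth.  Partial fractions for \<open>1\<close> and some \<open>w \<noteq> 1\<close> leave two terms: one in which \<open>w\<close> has
  been removed, where the induction hypothesis applies and the factor \<open>1 / (1 - w)\<close> of the limit
  appears, and one in which a \<open>1\<close> has been removed.  In the latter all multiplicities are at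
  most \<open>r\<close>, so it is negligible by \<open>geometric_product_bound\<close>.
\<close>
lemma geometric_product_asymptotic:
  assumes "\<And>z. z \<in># Z \<Longrightarrow> norm z \<le> 1" "count Z 1 = Suc r" "\<And>z. z \<noteq> 1 \<Longrightarrow> count Z z \<le> r"
  shows "(\<lambda>n. fps_nth (geometric_product Z) n / of_nat n ^ r) \<longlonglongrightarrow>
    (\<Prod>z\<in>#filter_mset (\<lambda>z. z \<noteq> 1) Z. inverse (1 - z)) / fact r"
  using assms
proof (induction "size Z" arbitrary: Z rule: less_induct)
  case less
  show ?case
  proof (cases "filter_mset (\<lambda>z. z \<noteq> 1) Z = {#}")
    case True
    then have "Z = replicate_mset (Suc r) 1"
      using less.prems(2) by (metis filter_eq_replicate_mset multiset_partition union_commute add_0 filter_mset_cong)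
    then show ?thesis
      using choose_asymptotic[of r] True by (simp only: geometric_product_replicate_1_nth) simp
  next
    case False
    then obtain w where w: "w \<in># Z" "w \<noteq> 1"
      by (metis (mono_tags, lifting) filter_mset_eq_conv multiset_nonemptyE set_mset_filter mem_Collect_eq)
    moreover have "1 \<in># Z"
      using less.prems(2) by (simp flip: count_greater_zero_iff)
    ultimately obtain Y where Y: "Z = add_mset 1 (add_mset w Y)"
      by (metis insert_noteq_member mset_add)
    \<comment> \<open>Since \<open>w\<close> occurs, \<open>r\<close> is positive, and \<open>n^(r-1)\<close> makes sense as an error bound.\<close>
    have "count Z w \<le> r" "count Z w > 0"
      using less.prems(3) w by auto
    then obtain t where t: "r = Suc t"
      by (cases r) auto
    have main: "(\<lambda>n. fps_nth (geometric_product (add_mset 1 Y)) n / of_nat n ^ r) \<longlonglongrightarrow>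
        (\<Prod>z\<in>#filter_mset (\<lambda>z. z \<noteq> 1) (add_mset 1 Y). inverse (1 - z)) / fact r"
    proof (rule less.hyps)
      show "count (add_mset 1 Y) z \<le> r" if "z \<noteq> 1" for z
        using less.prems(3)[OF that] that by (simp add: Y split: if_splits)
    qed (use less.prems w in \<open>auto simp: Y\<close>)
    obtain C where C: "\<And>n. norm (fps_nth (geometric_product (add_mset w Y)) n) \<le> C * real (Suc n) ^ t"
    proof (rule geometric_product_bound)
      show "count (add_mset w Y) z \<le> Suc t" for z
        using less.prems(2) less.prems(3)[of z] w by (cases "z = 1") (auto simp: Y t)
    qed (use less.prems in \<open>auto simp: Y\<close>)
    have "(\<lambda>n. C * (1 + inverse (real n)) ^ t * inverse (real n)) \<longlonglongrightarrow> C * (1 + 0) ^ t * 0"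
      by (intro tendsto_intros lim_inverse_n)
    then have null: "(\<lambda>n. C * (1 + inverse (real n)) ^ t * inverse (real n)) \<longlonglongrightarrow> 0"
      by simp
    have bound: "\<forall>\<^sub>F n in sequentially. norm (fps_nth (geometric_product (add_mset w Y)) n / of_nat n ^ r)
        \<le> C * (1 + inverse (real n)) ^ t * inverse (real n)"
      using eventually_gt_at_top[of 0]
    proof eventually_elim
      case (elim n)
      have "norm (fps_nth (geometric_product (add_mset w Y)) n / of_nat n ^ r) \<le> C * real (Suc n) ^ t / real n ^ r"
        using C[of n] by (simp add: norm_divide norm_power divide_right_mono)
      also have "\<dots> = C * (real (Suc n) / real n) ^ t * inverse (real n)"
        by (simp add: t power_divide field_simps)
      also have "real (Suc n) / real n = 1 + inverse (real n)"
        using elim by (simp add: field_simps)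
      finally show ?case .
    qed
    have "(\<lambda>n. norm (fps_nth (geometric_product (add_mset w Y)) n / of_nat n ^ r)) \<longlonglongrightarrow> 0"
      by (rule tendsto_sandwich[OF always_eventually bound tendsto_const null])
         (simp only: norm_ge_zero simp_thms)
    then have small: "(\<lambda>n. fps_nth (geometric_product (add_mset w Y)) n / of_nat n ^ r) \<longlonglongrightarrow> 0"
      by (rule tendsto_norm_zero_cancel)
    have "(\<lambda>n. (1 * (fps_nth (geometric_product (add_mset 1 Y)) n / of_nat n ^ r)
        - w * (fps_nth (geometric_product (add_mset w Y)) n / of_nat n ^ r)) / (1 - w)) \<longlonglongrightarrow>
        (1 * ((\<Prod>z\<in>#filter_mset (\<lambda>z. z \<noteq> 1) (add_mset 1 Y). inverse (1 - z)) / fact r) - w * 0) / (1 - w)"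
      using w(2) by (intro tendsto_divide tendsto_diff tendsto_mult tendsto_const main small) simp
    moreover have "(1 * (fps_nth (geometric_product (add_mset 1 Y)) n / of_nat n ^ r)
        - w * (fps_nth (geometric_product (add_mset w Y)) n / of_nat n ^ r)) / (1 - w) =
        fps_nth (geometric_product Z) n / of_nat n ^ r" for n
      unfolding Y geometric_product_partial_fractions[OF w(2)[symmetric]]
      by (simp add: diff_divide_distrib mult.commute del: geometric_product_simps)
    moreover have "(1 * ((\<Prod>z\<in>#filter_mset (\<lambda>z. z \<noteq> 1) (add_mset 1 Y). inverse (1 - z)) / fact r) - w * 0) / (1 - w) =
        (\<Prod>z\<in>#filter_mset (\<lambda>z. z \<noteq> 1) Z. inverse (1 - z)) / fact r"
      using w(2) by (simp add: Y divide_inverse mult_ac)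
    ultimately show ?thesis
      by (simp only:)
  qed
qed

section \<open>The poles of the generating function\<close>

text \<open>
  The reversal of the factorization of \<open>x^a - 1\<close> into its linear factors \<open>x - z\<close>, which are
  distinct because \<open>x^a - 1\<close> and its derivative have no common root.
\<close>
lemma one_minus_fps_X_power_factorization:
  assumes "a > 0"
  shows "(1 - fps_X ^ a :: complex fps) = (\<Prod>z | z ^ a = 1. 1 - fps_const z * fps_X)"
proof -
  let ?p = "monom 1 a - 1 :: complex poly"
  have deg: "degree ?p = a"
    using assms degree_add_eq_left[of "- 1" "monom 1 a :: complex poly"] by (simp add: degree_monom_eq)
  have lead: "lead_coeff ?p = 1"
    using assms unfolding deg by simp
  have roots: "poly ?p z = 0 \<longleftrightarrow> z ^ a = 1" for z
    by (simp add: poly_monom)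
  have "rsquarefree ?p"
    unfolding rsquarefree_roots
    using assms by (auto simp: poly_monom pderiv_diff pderiv_monom power_0_left)
  from complex_poly_decompose_rsquarefree[OF this]
  have "(\<Prod>z | z ^ a = 1. [:- z, 1:]) = ?p"
    by (simp only: lead roots smult_1_left)
  then have "reflect_poly ?p = (\<Prod>z | z ^ a = 1. reflect_poly [:- z, 1:])"
    by (metis reflect_poly_prod)
  moreover have "reflect_poly [:- z, 1:] = [:1, - z:]" for z :: complex
    by (rule poly_eqI) (simp add: coeff_reflect_poly coeff_pCons split: nat.split)
  moreover have "reflect_poly ?p = (1 - monom 1 a :: complex poly)"
    by (rule poly_eqI) (use assms in \<open>auto simp: coeff_reflect_poly deg\<close>)
  ultimately have "1 - monom 1 a = (\<Prod>z | z ^ a = 1. [:1, - z:] :: complex poly)"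
    by simp
  then have "fps_of_poly (1 - monom 1 a :: complex poly) = (\<Prod>z | z ^ a = 1. fps_of_poly [:1, - z:])"
    by (simp only: fps_of_poly_prod)
  then show ?thesis
    by (simp add: fps_of_poly_diff fps_of_poly_monom' fps_of_poly_pCons mult.commute flip: fps_const_neg)
qed

text \<open>
  The multiset of all \<open>z\<close> for which \<open>1 / z\<close> is a pole of the generating function, repeated according
  to the order of the pole.
\<close>
definition pole_multiset :: "nat multiset \<Rightarrow> complex multiset" where
  "pole_multiset A = (\<Sum>a\<in>#A. mset_set {z. z ^ a = 1})"

lemma count_pole_multiset:
  assumes "\<forall>a\<in>#A. a > 0"
  shows "count (pole_multiset A) z = size (filter_mset (\<lambda>a. z ^ a = 1) A)"
  using assms
proof (induction A)
  case empty
  show ?case by (simp add: pole_multiset_def)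
next
  case (add a A)
  then have "finite {z :: complex. z ^ a = 1}"
    by (intro finite_roots_unity) (simp add: Suc_le_eq)
  then show ?case
    using add by (simp add: pole_multiset_def)
qed

lemma norm_pole_multiset:
  assumes "\<forall>a\<in>#A. a > 0" "z \<in># pole_multiset A"
  shows "norm z = 1"
proof -
  have "filter_mset (\<lambda>a. z ^ a = 1) A \<noteq> {#}"
    using assms(2) by (metis assms(1) count_pole_multiset not_in_iff size_empty)
  then obtain a where "a \<in># filter_mset (\<lambda>a. z ^ a = 1) A"
    by (rule multiset_nonemptyE)
  then have a: "a \<in># A" "z ^ a = 1"
    by simp_all
  then have "norm z ^ a = 1 ^ a"
    by (simp flip: norm_power)
  moreover have "a > 0"
    using assms(1) a(1) by blast
  ultimately show ?thesis
    by (rule power_eq_imp_eq_base[OF _ norm_ge_zero zero_le_one])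
qed

lemma A_partition_function_eq_geometric_product:
  assumes "\<forall>a\<in>#A. a > 0"
  shows "of_nat (A_partition_function A n) = fps_nth (geometric_product (pole_multiset A)) n"
proof -
  have "Abs_fps (\<lambda>n. of_nat (A_partition_function A n)) = geometric_product (pole_multiset A)"
    using assms
  proof (induction A)
    case empty
    show ?case by (rule fps_ext) (simp add: A_partition_function_empty pole_multiset_def)
  next
    case (add a A)
    let ?F = "Abs_fps (\<lambda>n. of_nat (A_partition_function (add_mset a A) n)) :: complex fps"
    let ?G = "Abs_fps (\<lambda>n. of_nat (A_partition_function A n)) :: complex fps"
    let ?R = "geometric_product (mset_set {z. z ^ a = 1})"
    have "?F = ?G + ?F * fps_X ^ a"
    proof (rule fps_ext)
      fix n
      show "fps_nth ?F n = fps_nth (?G + ?F * fps_X ^ a) n"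
        using A_partition_function_add_mset[OF add.prems, of n]
        by (auto simp: fps_X_power_mult_right_nth)
    qed
    then have "?F * (1 - fps_X ^ a) = ?G"
      by (simp add: algebra_simps)
    moreover have "?R * (1 - fps_X ^ a) = 1"
    proof -
      have "?R * (1 - fps_X ^ a) =
          (\<Prod>z | z ^ a = 1. inverse (1 - fps_const z * fps_X) * (1 - fps_const z * fps_X))"
        using add.prems
        by (simp only: one_minus_fps_X_power_factorization geometric_product_def prod.distrib
            prod_unfold_prod_mset) (simp add: one_minus_fps_X_power_factorization prod_unfold_prod_mset)
      also have "\<dots> = 1"
        by (rule prod.neutral) (simp add: inverse_mult_eq_1)
      finally show ?thesis .
    qed
    ultimately have "?R * ?G = ?F"
      by (simp only: mult.left_commute[of ?R] mult_1_right flip: \<open>?F * (1 - fps_X ^ a) = ?G\<close>)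
    then show ?case
      using add by (simp add: pole_multiset_def)
  qed
  then show ?thesis
    by (metis fps_nth_Abs_fps)
qed

text \<open>The exponents \<open>a\<close> with \<open>z^a = 1\<close> are closed under \<open>gcd\<close>, by Bezout's identity.\<close>
lemma power_Gcd_eq_1:
  fixes z :: "'a :: field"
  assumes "finite S" "\<And>a. a \<in> S \<Longrightarrow> z ^ a = 1"
  shows "z ^ Gcd S = 1"
  using assms
proof (induction S rule: finite_induct)
  case empty
  show ?case by simp
next
  case (insert a S)
  show ?case
  proof (cases "a = 0")
    case True
    then show ?thesis using insert by simp
  next
    case False
    then obtain x y where "a * x = Gcd S * y + gcd a (Gcd S)"
      using bezout_nat by blast
    then have "z ^ (a * x) = z ^ (Gcd S * y) * z ^ gcd a (Gcd S)"
      by (simp add: power_add)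
    then show ?thesis
      using insert by (simp add: power_mult)
  qed
qed

text \<open>
  If \<open>z\<close> had order at least \<open>s\<close> as a pole, then \<open>z^a = 1\<close> for \<open>s\<close> elements \<open>a\<close> of \<open>A\<close>, hence also
  \<open>z^1 = 1\<close>, because \<open>1\<close> is their greatest common divisor.
\<close>
lemma count_pole_multiset_less:
  assumes "\<forall>a\<in>#A. a > 0" and "z \<noteq> 1"
    and gcd: "\<forall>B. B \<subseteq># A \<and> size B = s \<longrightarrow> Gcd (set_mset B) = 1"
  shows "count (pole_multiset A) z < s"
proof (rule ccontr)
  assume "\<not> ?thesis"
  then have large: "s \<le> size (filter_mset (\<lambda>a. z ^ a = 1) A)"
    using assms(1) by (simp add: count_pole_multiset)
  obtain xs where xs: "mset xs = filter_mset (\<lambda>a. z ^ a = 1) A"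
    using ex_mset by blast
  let ?B = "mset (take s xs)"
  have "?B \<subseteq># mset xs"
    by (metis append_take_drop_id mset_append mset_subset_eq_add_left)
  moreover have "size ?B = s"
    using large by (simp flip: xs)
  ultimately have "Gcd (set_mset ?B) = 1"
    using gcd xs by (metis multiset_filter_subset subset_mset.order_trans)
  moreover have "z ^ Gcd (set_mset ?B) = 1"
  proof (rule power_Gcd_eq_1)
    fix a assume "a \<in># ?B"
    then have "a \<in># mset xs"
      using \<open>?B \<subseteq># mset xs\<close> by (rule mset_subset_eqD[rotated])
    then show "z ^ a = 1"
      by (simp add: xs)
  qed simp
  ultimately show False
    using \<open>z \<noteq> 1\<close> by simp
qed

section \<open>Growth of the differences of the partition function\<close>

lemma funpow_forward_difference_of_real:
  "(forward_difference ^^ i) (\<lambda>n. of_real (u n)) n =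
    (of_real ((forward_difference ^^ i) u n) :: 'a :: real_normed_field)"
proof (induction i arbitrary: n)
  case 0
  show ?case by simp
next
  case (Suc i)
  then show ?case by (simp add: forward_difference_def)
qed

text \<open>
  Up to a shift of the index, a difference multiplies the generating function by \<open>1 - x\<close> and thus
  cancels one factor \<open>1 / (1 - x)\<close>.
\<close>
lemma funpow_forward_difference_geometric_product:
  "(forward_difference ^^ i) (fps_nth (geometric_product (replicate_mset i 1 + W))) =
    (\<lambda>n. fps_nth (geometric_product W) (n + i))"
proof (induction i arbitrary: W)
  case 0
  show ?case by simp
next
  case (Suc i)
  have "(forward_difference ^^ Suc i) (fps_nth (geometric_product (replicate_mset (Suc i) 1 + W))) =
      forward_difference (\<lambda>n. fps_nth (geometric_product (add_mset 1 W)) (n + i))"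
    using Suc.IH[of "add_mset 1 W"] by (simp del: geometric_product_simps)
  also have "\<dots> = (\<lambda>n. fps_nth (geometric_product W) (n + Suc i))"
    by (simp add: fun_eq_iff forward_difference_def geometric_product_add_mset_nth del: geometric_product_simps)
  finally show ?case .
qed

text \<open>
  The limit is stated over the complex numbers, where the constant lives, and the product in it
  does not depend on \<open>i\<close>: only factors with \<open>z = 1\<close> are cancelled.
\<close>
lemma forward_difference_A_partition_function_asymptotic:
  assumes pos: "\<forall>a\<in>#A. a > 0" and size: "size A = Suc m"
    and i: "i \<le> m" and poles: "\<And>z. z \<noteq> 1 \<Longrightarrow> count (pole_multiset A) z \<le> m - i"
  shows "(\<lambda>n. complex_of_real ((forward_difference ^^ i) (\<lambda>n. real (A_partition_function A n)) n / real n ^ (m - i)))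
    \<longlonglongrightarrow> (\<Prod>z\<in>#filter_mset (\<lambda>z. z \<noteq> 1) (pole_multiset A). inverse (1 - z)) / fact (m - i)"
proof -
  let ?Z = "pole_multiset A"
  have one: "count ?Z 1 = Suc m"
    using pos size by (simp add: count_pole_multiset)
  define W where "W = ?Z - replicate_mset i 1"
  have "replicate_mset i 1 \<subseteq># ?Z"
    using one i by (simp flip: count_le_replicate_mset_subset_eq)
  then have Z: "?Z = replicate_mset i 1 + W"
    by (simp add: W_def)
  have filter_W: "filter_mset (\<lambda>z. z \<noteq> 1) W = filter_mset (\<lambda>z. z \<noteq> 1) ?Z"
    by (rule multiset_eqI) (simp add: Z)
  let ?c = "(\<Prod>z\<in>#filter_mset (\<lambda>z. z \<noteq> 1) ?Z. inverse (1 - z)) / fact (m - i)"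
  have "(\<lambda>n. fps_nth (geometric_product W) n / of_nat n ^ (m - i)) \<longlonglongrightarrow> ?c"
    unfolding filter_W[symmetric]
  proof (rule geometric_product_asymptotic)
    show "norm z \<le> 1" if "z \<in># W" for z
      using norm_pole_multiset[OF pos, of z] that by (simp add: Z)
    show "count W 1 = Suc (m - i)"
      using one i by (simp add: Z)
    show "count W z \<le> m - i" if "z \<noteq> 1" for z
      using poles[OF that] that by (simp add: Z)
  qed
  then have lim: "(\<lambda>n. fps_nth (geometric_product W) (n + i) / of_nat (n + i) ^ (m - i)) \<longlonglongrightarrow> ?c"
    by (rule LIMSEQ_ignore_initial_segment)
  \<comment> \<open>The shift by \<open>i\<close> changes the growth only by the factor \<open>((n + i) / n)^(m - i)\<close>, which tends to \<open>1\<close>.\<close>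
  have "(\<lambda>n. (1 + of_nat i * inverse (of_nat n)) ^ (m - i)) \<longlonglongrightarrow> (1 + of_nat i * (0 :: complex)) ^ (m - i)"
    by (intro tendsto_intros lim_inverse_n)
  with lim have "(\<lambda>n. fps_nth (geometric_product W) (n + i) / of_nat (n + i) ^ (m - i) *
      (1 + of_nat i * inverse (of_nat n)) ^ (m - i)) \<longlonglongrightarrow> ?c * (1 + of_nat i * 0) ^ (m - i)"
    by (rule tendsto_mult)
  then have "(\<lambda>n. fps_nth (geometric_product W) (n + i) / of_nat (n + i) ^ (m - i) *
      (1 + of_nat i * inverse (of_nat n)) ^ (m - i)) \<longlonglongrightarrow> ?c"
    by simp
  then show ?thesis
  proof (rule Lim_transform_eventually)
    show "\<forall>\<^sub>F n in sequentially. fps_nth (geometric_product W) (n + i) / of_nat (n + i) ^ (m - i) *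
        (1 + of_nat i * inverse (of_nat n)) ^ (m - i) =
      complex_of_real ((forward_difference ^^ i) (\<lambda>n. real (A_partition_function A n)) n / real n ^ (m - i))"
      using eventually_gt_at_top[of 0]
    proof eventually_elim
      case (elim n)
      have "complex_of_real ((forward_difference ^^ i) (\<lambda>n. real (A_partition_function A n)) n) =
          (forward_difference ^^ i) (fps_nth (geometric_product ?Z)) n"
        using pos by (simp add: A_partition_function_eq_geometric_product flip: funpow_forward_difference_of_real)
      also have "\<dots> = fps_nth (geometric_product W) (n + i)"
        by (simp only: Z funpow_forward_difference_geometric_product)
      finally have "complex_of_real ((forward_difference ^^ i) (\<lambda>n. real (A_partition_function A n)) n) =
          fps_nth (geometric_product W) (n + i)" .
      moreover have "1 + of_nat i * inverse (of_nat n) = (of_nat (n + i) / of_nat n :: complex)"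
        using elim by (simp add: field_simps)
      moreover have "of_nat (n + i) \<noteq> (0 :: complex)"
        using elim by (simp only: of_nat_eq_0_iff)
      ultimately show ?case
        by (simp add: power_divide del: of_nat_add)
    qed
  qed
qed

theorem theorem4p4:
  fixes A :: "nat multiset" and k d :: nat
  assumes "\<forall>a \<in># A. a > 0"
    and "size A = k"
    and "1 \<le> 2 * d" and "2 * d < k"
    and "\<forall>B. B \<subseteq># A \<and> size B = k - 2 * d \<longrightarrow> Gcd (set_mset B) = 1"
  shows "\<forall>j. 1 \<le> j \<and> j \<le> d \<longrightarrow>
    finite {n. \<not> laguerre_inequality j (\<lambda>m. real (A_partition_function A m)) n}"
proof (intro allI impI)
  fix j assume "1 \<le> j \<and> j \<le> d"
  then have j: "j \<le> d" by simp
  obtain m where m: "k = Suc m"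
    using assms(4) by (cases k) auto
  define c where "c = (\<Prod>z\<in>#filter_mset (\<lambda>z. z \<noteq> 1) (pole_multiset A). inverse (1 - z))"
  let ?u = "\<lambda>i n. (forward_difference ^^ i) (\<lambda>m. real (A_partition_function A m)) n / real n ^ (m - i)"
  have lim: "(\<lambda>n. complex_of_real (?u i n)) \<longlonglongrightarrow> c / of_real (fact (m - i))" if "i \<le> 2 * d" for i
    unfolding c_def of_real_fact
  proof (rule forward_difference_A_partition_function_asymptotic)
    show "count (pole_multiset A) z \<le> m - i" if "z \<noteq> 1" for z
      using count_pole_multiset_less[OF assms(1) that assms(5)] \<open>i \<le> 2 * d\<close> m by linarith
  qed (use assms that m in auto)
  have Re_lim: "?u i \<longlonglongrightarrow> Re c / fact (m - i)" if "i \<le> 2 * d" for i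
    using tendsto_Re[OF lim[OF that]] by (simp only: Re_complex_of_real Re_divide_of_real)
  have "c \<noteq> 0"
    by (auto simp: c_def)
  \<comment> \<open>For \<open>i = 0\<close> the limit \<open>c / m!\<close> is one of real numbers.\<close>
  moreover have "Im c = 0"
  proof -
    have "(\<lambda>n. 0 :: real) \<longlonglongrightarrow> Im (c / of_real (fact m))"
      using tendsto_Im[OF lim[of 0]] by (simp only: Im_complex_of_real diff_zero)
    then have "Im (c / of_real (fact m)) = 0"
      by (simp only: LIMSEQ_const_iff)
    then show ?thesis
      by (simp only: Im_divide_of_real) simp
  qed
  ultimately have "Re c \<noteq> 0"
    by (simp add: complex_eq_iff)
  then have "\<forall>\<^sub>F n in sequentially. laguerre_inequality j (\<lambda>m. real (A_partition_function A m)) n"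
  proof (rule eventually_laguerre_inequality[where m = m])
    show "2 * j \<le> m"
      using j assms(4) m by simp
    show "?u i \<longlonglongrightarrow> Re c / fact (m - i)" if "i \<le> 2 * j" for i
      using that j by (intro Re_lim) simp
  qed
  then show "finite {n. \<not> laguerre_inequality j (\<lambda>m. real (A_partition_function A m)) n}"
    by (simp add: eventually_cofinite flip: cofinite_eq_sequentially)
qed

end
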